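(* Let $\mathcal{G}=(\mathcal{V},\mathcal{E})$ be a finite directed graph, let $Q\in\mathbb{Z}_{\ge 0}$, let $F_v:\mathbb{R}\to\mathbb{R}$ ($v\in\mathcal{V}$) and $G_{uv}:\mathbb{R}\to\mathbb{R}$ ($uv\in\mathcal{E}$) be convex functions, and set $$J(x)=\sum_{v\in\mathcal{V}}F_v(x_v)+\sum_{uv\in\mathcal{E}}G_{uv}(x_u-x_v).$$ Suppose $x\in\{0,1,\ldots,Q\}^{\mathcal{V}}$ satisfies: for every nonempty $S\subset\mathcal{V}$ inducing a connected subgraph of $\mathcal{G}$ and every sign $\sigma\in\{+1,-1\}$ such that $x+\sigma\chi_S\in\{0,1,\ldots,Q\}^{\mathcal{V}}$, we have $J(x)\le J(x+\sigma\chi_S)$. Then $x$ is a global minimizer of $J$ over $\{0,1,\ldots,Q\}^{\mathcal{V}}$.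
   Context: A directed graph is $\mathcal{G}=(\mathcal{V},\mathcal{E})$ with $\mathcal{E}\subset\mathcal{V}\times\mathcal{V}$; $uv$ denotes the edge leaving $u$ and arriving at $v$. The subgraph induced by $S\subset\mathcal{V}$ is $(S,\mathcal{E}\cap(S\times S))$. "Connected" means weakly connected (edge directions ignored). $\chi_S\in\{0,1\}^{\mathcal{V}}$ is the indicator vector of $S$. *)

theory Defs
  imports "HOL-Analysis.Analysis" "Graph_Theory.Digraph_Component"
begin

text \<open>Vectors indexed by the vertices are functions to the reals; the grid consists of
  extensional functions, so that its elements correspond one-to-one to vectors over the
  vertex set. Shifting a grid point by a multiple of the indicator of a set of vertices
  keeps it extensional.\<close>

definition grid :: "'a pair_pre_digraph \<Rightarrow> nat \<Rightarrow> ('a \<Rightarrow> real) set" where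
  "grid G Q = (pverts G \<rightarrow>\<^sub>E real ` {0..Q})"

definition energy ::
  "'a pair_pre_digraph \<Rightarrow> ('a \<Rightarrow> real \<Rightarrow> real) \<Rightarrow> ('a \<Rightarrow> 'a \<Rightarrow> real \<Rightarrow> real) \<Rightarrow> ('a \<Rightarrow> real) \<Rightarrow> real" where
  "energy G F g x = (\<Sum>v\<in>pverts G. F v (x v)) + (\<Sum>(u, v)\<in>parcs G. g u v (x u - x v))"

definition shift :: "('a \<Rightarrow> real) \<Rightarrow> real \<Rightarrow> 'a set \<Rightarrow> 'a \<Rightarrow> real" where
  "shift x \<sigma> S = (\<lambda>v. x v + \<sigma> * indicator S v)"

text \<open>The edges of the induced subgraph are those of the graph with both ends in the set;
  the connectedness predicate is that of the graph library (the symmetrised digraph is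
  strongly connected), not the topological one.\<close>

definition induces_connected :: "'a pair_pre_digraph \<Rightarrow> 'a set \<Rightarrow> bool" where
  "induces_connected G S \<longleftrightarrow> Digraph_Component.connected (induce_subgraph (with_proj G) S)"

end

theory Submission
  imports Defs
begin

text \<open>Moving \<open>x\<close> and \<open>y\<close> one unit towards each other on the set \<open>S\<close> of vertices where
  \<open>y\<close> exceeds \<open>x\<close> (or falls below it) does not increase \<open>J x + J y\<close>: on every vertex and
  every edge the two arguments move towards each other with constant sum. Hence, once no shift
  of \<open>x\<close> by an arbitrary vertex set decreases \<open>J\<close>, induction on the \<open>\<ell>\<^sup>1\<close>-distance from
  \<open>x\<close> to \<open>y\<close> gives \<open>J x \<le> J y\<close>. Connected sets suffice, since
  \<open>J (x + \<sigma> \<chi>\<^sub>S) - J x\<close> is additive over unions of sets without edges between them.\<close>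

text \<open>Both new points are convex combinations of \<open>a\<close> and \<open>b\<close>, with
  the weights \<open>1 - l\<close> and \<open>l\<close> exchanged, so adding the two convexity
  inequalities makes the weights at each endpoint sum to 1. The points may pass each other, as
  \<open>t\<close> ranges up to the full gap \<open>b - a\<close>; the disjunction covers both
  orders of \<open>a\<close> and \<open>b\<close>.\<close>

lemma convex_on_UNIV_move_inward:
  fixes h :: "real \<Rightarrow> real"
  assumes "convex_on UNIV h" and "0 \<le> t \<and> t \<le> b - a \<or> b - a \<le> t \<and> t \<le> 0"
  shows "h (a + t) + h (b - t) \<le> h a + h b"
proof (cases "a = b")
  case True
  then show ?thesis using assms(2) by auto
next
  case False
  define l where "l = t / (b - a)"
  have l: "0 \<le> l" "l \<le> 1"
    using assms(2) False by (auto simp: l_def divide_simps)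
  have t: "t = l * (b - a)"
    using False by (simp add: l_def)
  have "a + t = (1 - l) * a + l * b" and "b - t = (1 - l) * b + l * a"
    unfolding t by (simp_all add: algebra_simps)
  then have "h (a + t) \<le> (1 - l) * h a + l * h b" and "h (b - t) \<le> (1 - l) * h b + l * h a"
    using convex_onD[OF assms(1) l, of a b] convex_onD[OF assms(1) l, of b a] by simp_all
  then show ?thesis by (simp add: algebra_simps)
qed

lemma energy_exchange:
  assumes F: "\<And>v. v \<in> pverts G \<Longrightarrow> convex_on UNIV (F v)"
    and g: "\<And>u v. (u, v) \<in> parcs G \<Longrightarrow> convex_on UNIV (g u v)"
    and \<sigma>: "\<sigma> \<in> {1, -1}"
    and S: "\<And>v. v \<in> S \<Longrightarrow> 1 \<le> \<sigma> * (y v - x v)"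
    and nS: "\<And>v. v \<in> pverts G \<Longrightarrow> v \<notin> S \<Longrightarrow> \<sigma> * (y v - x v) \<le> 0"
    and wf: "pair_wf_digraph G"
  shows "energy G F g (shift x \<sigma> S) + energy G F g (shift y (- \<sigma>) S)
    \<le> energy G F g x + energy G F g y"
proof -
  interpret pair_wf_digraph G by fact
  have V: "F v (shift x \<sigma> S v) + F v (shift y (- \<sigma>) S v) \<le> F v (x v) + F v (y v)"
    if "v \<in> pverts G" for v
    using convex_on_UNIV_move_inward[OF F[OF that], of "\<sigma> * indicator S v" "y v" "x v"]
      S[of v] \<sigma> by (cases "v \<in> S") (auto simp: shift_def)
  have E: "g u v (shift x \<sigma> S u - shift x \<sigma> S v)
      + g u v (shift y (- \<sigma>) S u - shift y (- \<sigma>) S v)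
      \<le> g u v (x u - x v) + g u v (y u - y v)"
    if "(u, v) \<in> parcs G" for u v
  proof -
    let ?t = "\<sigma> * (indicator S u - indicator S v)"
    \<comment> \<open>If both ends or neither lie in \<open>S\<close>, then \<open>?t = 0\<close>.
      If exactly one does, the signed gap \<open>\<sigma> * (y - x)\<close> is at least 1 at that
      end and at most 0 at the other, so the two edge differences are at least 1 apart and the unit
      step \<open>?t\<close> points from one towards the other.\<close>
    have "0 \<le> ?t \<and> ?t \<le> (y u - y v) - (x u - x v) \<or> (y u - y v) - (x u - x v) \<le> ?t \<and> ?t \<le> 0
        \<or> ?t = 0"
      using S[of u] S[of v] nS[of u] nS[of v] \<sigma> in_arcsD1[OF that] in_arcsD2[OF that]
      by (cases "u \<in> S"; cases "v \<in> S") auto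
    then show ?thesis
      using convex_on_UNIV_move_inward[OF g[OF that], of ?t "y u - y v" "x u - x v"]
      by (fastforce simp: shift_def algebra_simps)
  qed
  have "(\<Sum>v\<in>pverts G. F v (shift x \<sigma> S v) + F v (shift y (- \<sigma>) S v))
      \<le> (\<Sum>v\<in>pverts G. F v (x v) + F v (y v))"
    using V by (rule sum_mono)
  moreover have "(\<Sum>(u, v)\<in>parcs G. g u v (shift x \<sigma> S u - shift x \<sigma> S v)
        + g u v (shift y (- \<sigma>) S u - shift y (- \<sigma>) S v))
      \<le> (\<Sum>(u, v)\<in>parcs G. g u v (x u - x v) + g u v (y u - y v))"
    using E by (intro sum_mono) auto
  ultimately show ?thesis
    by (simp add: energy_def sum.distrib case_prod_beta)
qed

text \<open>No vertex and no edge meets both \<open>A\<close> and \<open>B\<close>. So in each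
  summand one of the two separate shifts agrees with the joint shift and the other changes nothing;
  the identity holds term by term.\<close>

lemma energy_shift_Un:
  assumes "A \<inter> B = {}"
    and "\<And>u v. (u, v) \<in> parcs G \<Longrightarrow> \<not> (u \<in> A \<and> v \<in> B) \<and> \<not> (u \<in> B \<and> v \<in> A)"
  shows "energy G F g (shift x \<sigma> (A \<union> B)) + energy G F g x
    = energy G F g (shift x \<sigma> A) + energy G F g (shift x \<sigma> B)"
proof -
  have V: "F v (shift x \<sigma> (A \<union> B) v) + F v (x v) = F v (shift x \<sigma> A v) + F v (shift x \<sigma> B v)" for v
    using assms(1) by (auto simp: shift_def indicator_def)
  have E: "g u v (shift x \<sigma> (A \<union> B) u - shift x \<sigma> (A \<union> B) v) + g u v (x u - x v)
      = g u v (shift x \<sigma> A u - shift x \<sigma> A v) + g u v (shift x \<sigma> B u - shift x \<sigma> B v)"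
    if "(u, v) \<in> parcs G" for u v
    using assms(1) assms(2)[OF that] by (auto simp: shift_def indicator_def)
  have "(\<Sum>v\<in>pverts G. F v (shift x \<sigma> (A \<union> B) v) + F v (x v))
      = (\<Sum>v\<in>pverts G. F v (shift x \<sigma> A v) + F v (shift x \<sigma> B v))"
    using V by simp
  moreover have "(\<Sum>(u, v)\<in>parcs G. g u v (shift x \<sigma> (A \<union> B) u - shift x \<sigma> (A \<union> B) v)
        + g u v (x u - x v))
      = (\<Sum>(u, v)\<in>parcs G. g u v (shift x \<sigma> A u - shift x \<sigma> A v)
        + g u v (shift x \<sigma> B u - shift x \<sigma> B v))"
    using E by (intro sum.cong) auto
  ultimately show ?thesis
    by (simp add: energy_def sum.distrib case_prod_beta)
qed

lemma not_induces_connected_split: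
  assumes "S \<noteq> {}" "\<not> induces_connected G S"
  obtains A B where "A \<noteq> {}" "B \<noteq> {}" "A \<inter> B = {}" "S = A \<union> B"
    "\<And>u v. (u, v) \<in> parcs G \<Longrightarrow> \<not> (u \<in> A \<and> v \<in> B) \<and> \<not> (u \<in> B \<and> v \<in> A)"
proof -
  define H where "H = mk_symmetric (induce_subgraph (with_proj G) S)"
  have vH: "pverts H = S"
    by (simp add: H_def)
  have aH: "(u, v) \<in> parcs H \<longleftrightarrow> u \<in> S \<and> v \<in> S \<and> ((u, v) \<in> parcs G \<or> (v, u) \<in> parcs G)" for u v
    by (force simp: H_def parcs_mk_symmetric)
  interpret H: pair_wf_digraph H
    by unfold_locales (use aH vH in force)+
  from assms obtain u w where uw: "u \<in> S" "w \<in> S" "\<not> u \<rightarrow>\<^sup>*\<^bsub>with_proj H\<^esub> w"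
    unfolding induces_connected_def connected_def strongly_connected_def H_def[symmetric]
    using vH by auto
  \<comment> \<open>One side of the split is everything reachable from \<open>u\<close>; the witness
    \<open>w\<close> keeps the other side nonempty. Since \<open>H\<close> is symmetric, closure of
    \<open>A\<close> under its arcs rules out crossing edges of \<open>G\<close> in both
    directions.\<close>
  define A where "A = {v \<in> S. u \<rightarrow>\<^sup>*\<^bsub>with_proj H\<^esub> v}"
  have closed: "q \<in> A" if "p \<in> A" "(p, q) \<in> parcs H" for p q
    using that H.reachable_adj_trans[of u p q] aH unfolding A_def by auto
  show ?thesis
  proof (rule that[of A "S - A"])
    show "A \<noteq> {}" using uw vH by (auto simp: A_def)
    show "S - A \<noteq> {}" using uw by (auto simp: A_def)
    show "\<not> (p \<in> A \<and> q \<in> S - A) \<and> \<not> (p \<in> S - A \<and> q \<in> A)" if "(p, q) \<in> parcs G" for p q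
      using closed[of p q] closed[of q p] aH that by (auto simp: A_def)
  qed (auto simp: A_def)
qed

lemma real_image_atMost_iff: "r \<in> real ` {0..Q} \<longleftrightarrow> r \<in> \<int> \<and> 0 \<le> r \<and> r \<le> real Q"
proof
  assume "r \<in> \<int> \<and> 0 \<le> r \<and> r \<le> real Q"
  then show "r \<in> real ` {0..Q}"
    by (intro image_eqI[where x = "nat \<lfloor>r\<rfloor>"]) (auto simp: nat_le_iff floor_le_iff elim: Ints_cases)
qed auto

text \<open>Adding \<sigma> preserves integrality, and values off \<open>S\<close> do not change, so
  only the bounds on \<open>S\<close> remain. The criterion is pointwise and hence passes to subsets
  of \<open>S\<close>.\<close>

lemma shift_in_grid_iff:
  assumes "x \<in> grid G Q" "S \<subseteq> pverts G" "\<sigma> \<in> {1, -1}"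
  shows "shift x \<sigma> S \<in> grid G Q \<longleftrightarrow> (\<forall>v\<in>S. 0 \<le> x v + \<sigma> \<and> x v + \<sigma> \<le> real Q)"
proof -
  have "shift x \<sigma> S v \<in> real ` {0..Q} \<longleftrightarrow> (v \<in> S \<longrightarrow> 0 \<le> x v + \<sigma> \<and> x v + \<sigma> \<le> real Q)"
    if "v \<in> pverts G" for v
  proof -
    have "x v \<in> \<int>" "0 \<le> x v" "x v \<le> real Q" "\<sigma> \<in> \<int>"
      using assms(1,3) that PiE_mem[of x "pverts G" "\<lambda>_. real ` {0..Q}" v]
      unfolding grid_def real_image_atMost_iff by auto
    then show ?thesis
      unfolding real_image_atMost_iff by (cases "v \<in> S") (auto simp: shift_def)
  qed
  moreover have "shift x \<sigma> S \<in> extensional (pverts G)"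
    using assms(1,2) by (auto simp: grid_def PiE_iff extensional_def shift_def indicator_def)
  ultimately show ?thesis
    using assms(2) unfolding grid_def PiE_iff by auto
qed

text \<open>Induction over proper subsets: a disconnected \<open>S\<close> splits into two smaller
  sets without edges between them, both shifts stay in the grid, and the energy increment of
  \<open>S\<close> is the sum of two nonnegative increments.\<close>

lemma energy_shift_ge:
  assumes x: "x \<in> grid G Q" and \<sigma>: "\<sigma> \<in> {1, -1}" and fin: "finite (pverts G)"
    and conn: "\<And>S. S \<noteq> {} \<Longrightarrow> S \<subseteq> pverts G \<Longrightarrow> induces_connected G S \<Longrightarrow>
      shift x \<sigma> S \<in> grid G Q \<Longrightarrow> energy G F g x \<le> energy G F g (shift x \<sigma> S)"
    and S: "S \<subseteq> pverts G" "shift x \<sigma> S \<in> grid G Q"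
  shows "energy G F g x \<le> energy G F g (shift x \<sigma> S)"
proof -
  have "finite S"
    using fin S(1) by (rule finite_subset[rotated])
  then show ?thesis using S
  proof (induction S rule: finite_psubset_induct)
    case (psubset S)
    consider "S = {}" | "S \<noteq> {}" "induces_connected G S" | "S \<noteq> {}" "\<not> induces_connected G S"
      by blast
    then show ?case
    proof cases
      case 1
      then show ?thesis by (simp add: shift_def)
    next
      case 2
      then show ?thesis using conn psubset.prems by blast
    next
      case 3
      then obtain A B where AB: "A \<noteq> {}" "B \<noteq> {}" "A \<inter> B = {}" "S = A \<union> B"
        and sep: "\<And>u v. (u, v) \<in> parcs G \<Longrightarrow> \<not> (u \<in> A \<and> v \<in> B) \<and> \<not> (u \<in> B \<and> v \<in> A)"
        using not_induces_connected_split by metis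
      have "shift x \<sigma> A \<in> grid G Q" "shift x \<sigma> B \<in> grid G Q"
        using psubset.prems AB(4) by (auto simp: shift_in_grid_iff[OF x _ \<sigma>])
      moreover have "A \<subset> S" "B \<subset> S"
        using AB by auto
      ultimately have "energy G F g x \<le> energy G F g (shift x \<sigma> A)"
          "energy G F g x \<le> energy G F g (shift x \<sigma> B)"
        using psubset by auto
      then show ?thesis
        using energy_shift_Un[OF AB(3) sep, of G F g x \<sigma>] AB(4) by simp
    qed
  qed
qed

theorem corollary3:
  fixes G :: "'a pair_pre_digraph"
    and Q :: nat
    and F :: "'a \<Rightarrow> real \<Rightarrow> real"
    and g :: "'a \<Rightarrow> 'a \<Rightarrow> real \<Rightarrow> real"
    and x :: "'a \<Rightarrow> real"
  assumes "pair_fin_digraph G"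
    and "\<And>v. v \<in> pverts G \<Longrightarrow> convex_on UNIV (F v)"
    and "\<And>u v. (u, v) \<in> parcs G \<Longrightarrow> convex_on UNIV (g u v)"
    and "x \<in> grid G Q"
    and "\<And>S \<sigma>. S \<noteq> {} \<Longrightarrow> S \<subseteq> pverts G \<Longrightarrow> induces_connected G S \<Longrightarrow> \<sigma> \<in> {1, -1} \<Longrightarrow>
           shift x \<sigma> S \<in> grid G Q \<Longrightarrow> energy G F g x \<le> energy G F g (shift x \<sigma> S)"
  shows "is_arg_min (energy G F g) (\<lambda>y. y \<in> grid G Q) x"
proof -
  interpret pair_fin_digraph G by fact
  have fin: "finite (pverts G)" by (rule pair_finite_verts)
  have grid: "z v \<in> \<int>" "0 \<le> z v" "z v \<le> real Q" if "z \<in> grid G Q" "v \<in> pverts G" for z v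
    using that PiE_mem[of z "pverts G" "\<lambda>_. real ` {0..Q}" v]
    unfolding grid_def real_image_atMost_iff by auto
  have grid_ext: "y = x" if "y \<in> grid G Q" "\<forall>v\<in>pverts G. y v = x v" for y
    using that assms(4) unfolding grid_def by (intro PiE_ext) auto
  have "energy G F g x \<le> energy G F g y"
    if "y \<in> grid G Q" "(\<Sum>v\<in>pverts G. \<bar>y v - x v\<bar>) \<le> real n" for y n
    using that
  proof (induction n arbitrary: y)
    case 0
    then have "(\<Sum>v\<in>pverts G. \<bar>y v - x v\<bar>) = 0"
      by (intro antisym sum_nonneg) auto
    then have "\<forall>v\<in>pverts G. y v = x v"
      by (simp add: sum_nonneg_eq_0_iff fin)
    then have "y = x"
      using 0 grid_ext by blast
    then show ?case by simp
  next
    case (Suc n)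
    show ?case
    proof (cases "y = x")
      case False
      then obtain w where w: "w \<in> pverts G" "y w \<noteq> x w"
        using Suc.prems(1) grid_ext by blast
      \<comment> \<open>The sign is read off at a vertex where \<open>x\<close> and \<open>y\<close>
        differ, so that \<open>w\<close> lies in \<open>S\<close> and the step makes
        progress.\<close>
      define \<sigma> :: real where "\<sigma> = sgn (y w - x w)"
      have \<sigma>: "\<sigma> \<in> {1, -1}"
        using w by (auto simp: \<sigma>_def sgn_if)
      define S where "S = {v \<in> pverts G. 0 < \<sigma> * (y v - x v)}"
      have SV: "S \<subseteq> pverts G" by (auto simp: S_def)
      have wS: "w \<in> S"
        using w by (auto simp: S_def \<sigma>_def sgn_if)
      \<comment> \<open>Grid values are integers, so a positive gap is at least 1 and a unit move
        cannot overshoot.\<close>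
      have S1: "1 \<le> \<sigma> * (y v - x v)" if "v \<in> S" for v
      proof -
        have "\<sigma> * (y v - x v) \<in> \<int>"
          using that SV \<sigma> grid[OF Suc.prems(1), of v] grid[OF assms(4), of v] by auto
        then obtain k where k: "\<sigma> * (y v - x v) = real_of_int k"
          by (auto elim: Ints_cases)
        then have "0 < k" using that by (simp add: S_def)
        then show ?thesis unfolding k by simp
      qed
      let ?y = "shift y (- \<sigma>) S"
      \<comment> \<open>On \<open>S\<close> both moved values lie between \<open>x v\<close> and
        \<open>y v\<close>, hence within the bounds.\<close>
      have "0 \<le> x v + \<sigma> \<and> x v + \<sigma> \<le> real Q \<and> 0 \<le> y v + - \<sigma> \<and> y v + - \<sigma> \<le> real Q"
        if "v \<in> S" for v
        using \<sigma> S1[OF that] grid(2,3)[OF Suc.prems(1), of v] grid(2,3)[OF assms(4), of v] that SV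
        by auto
      then have xS: "shift x \<sigma> S \<in> grid G Q" and yS: "?y \<in> grid G Q"
        using \<sigma> shift_in_grid_iff[OF assms(4) SV \<sigma>] shift_in_grid_iff[OF Suc.prems(1) SV, of "- \<sigma>"]
        by auto
      have dist: "\<bar>?y v - x v\<bar> = \<bar>y v - x v\<bar> - indicator S v" for v
        using \<sigma> S1[of v] by (cases "v \<in> S") (auto simp: shift_def)
      \<comment> \<open>The vertex \<open>w\<close> alone makes the distance drop by at least 1,
        which matches the step from \<open>Suc n\<close> to \<open>n\<close>.\<close>
      have "(\<Sum>v\<in>pverts G. indicator S v) \<ge> (1::real)"
        using member_le_sum[OF w(1), of "indicator S :: _ \<Rightarrow> real"] fin wS by simp
      then have "(\<Sum>v\<in>pverts G. \<bar>?y v - x v\<bar>) \<le> real n"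
        using Suc.prems(2) unfolding dist sum_subtractf by simp
      then have "energy G F g x \<le> energy G F g ?y"
        using Suc.IH yS by blast
      moreover have "energy G F g x \<le> energy G F g (shift x \<sigma> S)"
        using energy_shift_ge[OF assms(4) \<sigma> fin _ SV xS] assms(5) \<sigma> by blast
      \<comment> \<open>The two preceding bounds make the left-hand side at least twice the energy
        of \<open>x\<close>; cancelling one copy gives the claim.\<close>
      moreover have "energy G F g (shift x \<sigma> S) + energy G F g ?y
          \<le> energy G F g x + energy G F g y"
        using assms(2,3) \<sigma> S1 by (rule energy_exchange) (auto simp: S_def, unfold_locales)
      ultimately show ?thesis by simp
    qed simp
  qed
  then have "energy G F g x \<le> energy G F g y" if "y \<in> grid G Q" for y
    using that real_arch_simple by blast
  then show ?thesis
    using assms(4) by (auto simp: is_arg_min_def not_less)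
qed

end
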